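(* For all $f, g\in C^{2}[0, 1]$ (real-valued), all $n\in \mathbb{N}$ (i.e. $n\ge 1$) and all $x, y\in [0, 1]$ with $x\neq y$, we have $$ \begin{aligned} &\Big|K_{n}(f g)(x)-K_{n}(f)(x)\cdot K_{n}(g)(x)+(x-y)\cdot \frac{1-2x}{2(n+1)}\big([x, y; f]\cdot [x, y; g]-f^{\prime}(x)g^{\prime}(x)\big)\Big|\\ &\le \left[\frac{1}{(n+1)^{2}}\left(x(1-x)(n-1)+ \frac13\right)+|x-y|\cdot \frac{1}{\sqrt{3}\sqrt{n+1}}\right]\\ &\quad\cdot \left[\omega_{1}\left((f g)^{\prime \prime}; |x-y|+\frac{2 \sqrt{6}}{\sqrt{n+1}}\right)+\|g\|\,\omega_{1}\left(f^{\prime \prime}; |x-y|+\frac{2 \sqrt{6}}{\sqrt{n+1}}\right)+ \|f\|\,\omega_{1}\left(g^{\prime \prime}; |x-y|+\frac{2 \sqrt{6}}{\sqrt{n+1}}\right)\right]\\ &\quad+|K_{n}(f)(x)-f(x)|\cdot |K_{n}(g)(x)-g(x)|+|F_{n}(x)|\cdot |f^{\prime}(x)g^{\prime}(x)|. \end{aligned} $$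
   Context: For $f:[0,1]\to\mathbb{R}$ integrable on $[0,1]$ and $n\in\mathbb{N}$, the Bernstein-Kantorovich polynomial is $$K_{n}(f)(x)=\sum_{k=0}^{n}p_{n, k}(x)\cdot (n+1)\int_{k/(n+1)}^{(k+1)/(n+1)}f(t)\, dt,\qquad p_{n, k}(x)=\binom{n}{k}x^{k}(1-x)^{n-k},\quad x\in[0,1].$$ For $x\in[0,1]$, $$F_{n}(x)=\frac{1}{(n+1)^{2}}\left(x(1-x)(n-1) + \frac{1}{3}\right).$$ For $x\ne y$, $[x, y; f]=\frac{f(x)-f(y)}{x-y}$ is the divided difference. The modulus of continuity is $\omega_{1}(f; \delta)=\sup\{|f(u)-f(v)| : u, v\in [0, 1],\ |u-v|\le \delta\}$, and $\|f\|=\sup_{t\in[0,1]}|f(t)|$ is the uniform norm. *)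

theory Defs
  imports "HOL-Analysis.Analysis"
begin

text \<open>A real function on \<open>[0,1]\<close> is represented by a total function \<open>real \<Rightarrow> real\<close>; nothing below
  depends on its values outside \<open>[0,1]\<close>. In particular derivatives are taken within \<open>[0,1]\<close>,
  hence are one-sided at the endpoints.\<close>

definition deriv01 :: "(real \<Rightarrow> real) \<Rightarrow> real \<Rightarrow> real" where
  "deriv01 f x = vector_derivative f (at x within {0..1})"

definition C2_01 :: "(real \<Rightarrow> real) \<Rightarrow> bool" where
  "C2_01 f \<longleftrightarrow>
     f differentiable_on {0..1} \<and>
     deriv01 f differentiable_on {0..1} \<and>
     continuous_on {0..1} (deriv01 (deriv01 f))"

definition kantorovich :: "nat \<Rightarrow> (real \<Rightarrow> real) \<Rightarrow> real \<Rightarrow> real" where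
  "kantorovich n f x =
     (\<Sum>k\<le>n. Bernstein n k x *
        (real (n + 1) * integral {real k / real (n + 1) .. real (k + 1) / real (n + 1)} f))"

definition kant_F :: "nat \<Rightarrow> real \<Rightarrow> real" where
  "kant_F n x = 1 / (real n + 1)\<^sup>2 * (x * (1 - x) * (real n - 1) + 1 / 3)"

definition divided_difference :: "real \<Rightarrow> real \<Rightarrow> (real \<Rightarrow> real) \<Rightarrow> real" where
  "divided_difference x y f = (f x - f y) / (x - y)"

text \<open>Both suprema below are real-valued, hence meaningful only for functions bounded on
  \<open>[0,1]\<close> (and, for the modulus, for \<open>\<delta> \<ge> 0\<close>).\<close>

definition modulus_cont :: "(real \<Rightarrow> real) \<Rightarrow> real \<Rightarrow> real" where
  "modulus_cont f \<delta> = Sup {\<bar>f u - f v\<bar> | u v. u \<in> {0..1} \<and> v \<in> {0..1} \<and> \<bar>u - v\<bar> \<le> \<delta>}"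

definition sup_norm :: "(real \<Rightarrow> real) \<Rightarrow> real" where
  "sup_norm f = (SUP t\<in>{0..1}. \<bar>f t\<bar>)"

end

theory Submission
  imports Defs
begin

text \<open>Write \<open>m = K\<^sub>n(t - x)(x) = (1 - 2x)/(2(n+1))\<close> and \<open>F = F\<^sub>n(x) = K\<^sub>n((t - x)\<^sup>2)(x)\<close>. Interpolate
  \<open>h\<close> at the nodes \<open>x, y\<close> in Newton form; freezing the second derivative in the remainder at \<open>x\<close> gives
  \<open>K\<^sub>n h - h = [x,y;h] m + h''(x)/2 (F + (x - y) m) + R(h)\<close>. The product rules for divided
  differences and for second derivatives turn the quantity to be estimated into
  \<open>R(fg) - f R(g) - g R(f) - (K\<^sub>n f - f)(K\<^sub>n g - g) + F f'g'\<close>, so only \<open>R(h)\<close> has to be bounded.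
  By Rolle its integrand is at most
  \<open>1/2 \<bar>t-x\<bar> \<bar>t-y\<bar> (1 + \<bar>t-x\<bar>/\<delta>) \<omega>(h''; \<bar>x-y\<bar> + \<delta>)\<close>; the odd powers of \<open>\<bar>t-x\<bar>\<close> are removed by AM-GM,
  and \<open>\<delta> = 2\<surd>6/\<surd>(n+1)\<close> is chosen so that \<open>K\<^sub>n((t-x)\<^sup>4)(x) \<le> \<delta>\<^sup>2 F\<close>.\<close>

section \<open>Central moments of the binomial distribution\<close>

lemma Bernstein_Suc_Suc:
  "Bernstein (Suc n) (Suc k) x = x * Bernstein n k x + (1 - x) * Bernstein n (Suc k) x"
proof (cases "k < n")
  case True
  then have "(1 - x) ^ (n - k) = (1 - x) * (1 - x) ^ (n - Suc k)"
    by (metis Suc_diff_Suc power_Suc)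
  then show ?thesis
    by (simp add: Bernstein_def distrib_left distrib_right mult_ac)
\<comment> \<open>For \<open>k >= n\<close> the truncated exponent \<open>n - Suc k\<close> is
  harmless, because its coefficient \<open>n choose Suc k\<close> is zero.\<close>
next
  case False
  then show ?thesis
    by (simp add: Bernstein_def binomial_eq_0)
qed

text \<open>Conditioning on one additional Bernoulli trial: it fails with weight
  \<open>1 - x\<close> and succeeds with weight \<open>x\<close>. This drives the induction for the
  moments.\<close>

lemma sum_Bernstein_Suc:
  "(\<Sum>k\<le>Suc n. Bernstein (Suc n) k x * \<phi> k) =
   (\<Sum>k\<le>n. Bernstein n k x * ((1 - x) * \<phi> k + x * \<phi> (Suc k)))"
proof -
  have "(\<Sum>k\<le>Suc n. Bernstein (Suc n) k x * \<phi> k)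
      = (1 - x) * (Bernstein n 0 x * \<phi> 0 + (\<Sum>k\<le>n. Bernstein n (Suc k) x * \<phi> (Suc k)))
        + x * (\<Sum>k\<le>n. Bernstein n k x * \<phi> (Suc k))"
    unfolding sum.atMost_Suc_shift Bernstein_Suc_Suc
    by (simp add: Bernstein_def sum.distrib sum_distrib_left distrib_left distrib_right mult_ac)
  \<comment> \<open>Undoing the index shift gives a sum up to \<open>Suc n\<close>, whose last term
    is zero because \<open>n choose Suc n\<close> is.\<close>
  also have "Bernstein n 0 x * \<phi> 0 + (\<Sum>k\<le>n. Bernstein n (Suc k) x * \<phi> (Suc k))
      = (\<Sum>k\<le>n. Bernstein n k x * \<phi> k)"
    unfolding sum.atMost_Suc_shift[symmetric, where g="\<lambda>k. Bernstein n k x * \<phi> k"]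
    by (simp add: Bernstein_def binomial_eq_0)
  finally show ?thesis
    by (simp add: sum.distrib sum_distrib_left distrib_left mult_ac)
qed

text \<open>Arbitrary coefficients make the induction close: a further trial sends quartics in the
  centred variable to quartics, with new coefficients. \<open>c1\<close> disappears on the right
  since the first central moment is zero.\<close>

lemma sum_Bernstein_quartic:
  fixes x X :: real and n :: nat
  defines "X \<equiv> x * (1 - x)"
  shows "(\<Sum>k\<le>n. Bernstein n k x *
      (c0 + c1 * (real k - n * x) + c2 * (real k - n * x)^2 + c3 * (real k - n * x)^3 + c4 * (real k - n * x)^4))
    = c0 + c2 * (real n * X) + c3 * (real n * X * (1 - 2 * x)) + c4 * (3 * (real n)^2 * X^2 + real n * X * (1 - 6 * X))"
proof (induction n arbitrary: c0 c1 c2 c3 c4)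
  case 0
  show ?case by (simp add: Bernstein_def)
next
  case (Suc n)
  \<comment> \<open>The new deviation is \<open>u\<close> plus a centred Bernoulli variable, whose
    moments of order 1 to 4 are \<open>0\<close>, \<open>X\<close>, \<open>X * (1 - 2 * x)\<close>
    and \<open>X * (1 - 3 * X)\<close>.\<close>
  have *: "(1 - x) * (c0 + c1 * (real k - Suc n * x) + c2 * (real k - Suc n * x)^2
        + c3 * (real k - Suc n * x)^3 + c4 * (real k - Suc n * x)^4)
      + x * (c0 + c1 * (real (Suc k) - Suc n * x) + c2 * (real (Suc k) - Suc n * x)^2
        + c3 * (real (Suc k) - Suc n * x)^3 + c4 * (real (Suc k) - Suc n * x)^4)
     = (c0 + c2 * X + c3 * (X * (1 - 2 * x)) + c4 * (X * (1 - 3 * X)))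
       + (c1 + 3 * c3 * X + 4 * c4 * (X * (1 - 2 * x))) * (real k - n * x)
       + (c2 + 6 * c4 * X) * (real k - n * x)^2
       + c3 * (real k - n * x)^3 + c4 * (real k - n * x)^4" for k
  proof -
    define u where "u = real k - n * x"
    have "real k - Suc n * x = u - x" "real (Suc k) - Suc n * x = u + (1 - x)"
      by (simp_all add: u_def algebra_simps)
    then show ?thesis
      unfolding u_def[symmetric] X_def by algebra
  qed
  show ?case
    unfolding sum_Bernstein_Suc * Suc.IH
    unfolding X_def of_nat_Suc by algebra
qed

section \<open>Moments of the Kantorovich operator and their size\<close>

text \<open>The cell average of a polynomial is a scaled difference of its antiderivative at
  consecutive nodes, hence a polynomial in \<open>k - n * x\<close>, to which the binomial moments
  apply. The cubic power is left out because the later majorant contains only even powers.\<close>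

lemma kantorovich_quartic:
  fixes x X :: real and n :: nat
  defines "X \<equiv> x * (1 - x)"
  shows "kantorovich n (\<lambda>t. c0 + c1 * (t - x) + c2 * (t - x)^2 + c4 * (t - x)^4) x
    = c0 + c1 * ((1 - 2 * x) / (2 * (real n + 1))) + c2 * kant_F n x
      + c4 * ((3 * (real n)^2 * X^2 + real n * X * (5 - 20 * X) + ((1 - x)^5 + x^5) / 5) / (real n + 1)^4)"
proof -
  define N where "N = real n + 1"
  have N: "N > 0" and nN: "real n = N - 1" by (simp_all add: N_def)
  let ?P = "\<lambda>t. c0 * t + c1 / 2 * (t - x)^2 + c2 / 3 * (t - x)^3 + c4 / 5 * (t - x)^5"
  define d where "d = 1 / N"
  have d: "N * d = 1" using N by (simp add: d_def)
  define e1 e2 e4 where "e1 = c1 / 2" and "e2 = c2 / 3" and "e4 = c4 / 5"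
  have e: "c1 = 2 * e1" "c2 = 3 * e2" "c4 = 5 * e4"
    by (simp_all add: e1_def e2_def e4_def)
  \<comment> \<open>\<open>a0\<close> to \<open>a4\<close> are the coefficients of the cell average
    in powers of \<open>u = k - n * x\<close>. They come from expanding
    \<open>(u - x + 1)^j - (u - x)^j\<close> for \<open>j = 2, 3, 5\<close>; using \<open>d\<close>
    for \<open>1 / N\<close> keeps everything polynomial.\<close>
  define a0 where "a0 = c0 + e1 * d * (1 - 2 * x) + e2 * d^2 * (1 - 3 * X) + e4 * d^4 * ((1 - x)^5 + x^5)"
  define a1 where "a1 = 2 * e1 * d + 3 * e2 * d^2 * (1 - 2 * x) + 5 * e4 * d^4 * ((1 - x)^4 - x^4)"
  define a2 where "a2 = 3 * e2 * d^2 + 5 * e4 * d^4 * (2 - 6 * X)"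
  define a3 where "a3 = 5 * e4 * d^4 * (2 - 4 * x)"
  define a4 where "a4 = 5 * e4 * d^4"
  have I: "N * integral {real k / N .. real (k + 1) / N} (\<lambda>t. c0 + c1 * (t - x) + c2 * (t - x)^2 + c4 * (t - x)^4)
     = a0 + a1 * (real k - n * x) + a2 * (real k - n * x)^2 + a3 * (real k - n * x)^3 + a4 * (real k - n * x)^4" for k
  proof -
    define u where "u = real k - n * x"
    have "((\<lambda>t. c0 + c1 * (t - x) + c2 * (t - x)^2 + c4 * (t - x)^4) has_integral
        ?P (real (k + 1) / N) - ?P (real k / N)) {real k / N .. real (k + 1) / N}"
    proof (rule fundamental_theorem_of_calculus)
      show "real k / N \<le> real (k + 1) / N"
        using N by (simp add: divide_right_mono)
      show "(?P has_vector_derivative c0 + c1 * (t - x) + c2 * (t - x)^2 + c4 * (t - x)^4)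
          (at t within {real k / N..real (k + 1) / N})" for t
        unfolding has_real_derivative_iff_has_vector_derivative[symmetric]
        by (auto intro!: derivative_eq_intros)
    qed
    then have I: "integral {real k / N .. real (k + 1) / N} (\<lambda>t. c0 + c1 * (t - x) + c2 * (t - x)^2 + c4 * (t - x)^4)
        = ?P (real (k + 1) / N) - ?P (real k / N)"
      by (rule integral_unique)
    have a: "real k / N - x = (u - x) * d" and b: "real (k + 1) / N - x = (u - x + 1) * d"
      and c: "real (k + 1) / N = real k / N + d"
      using N by (simp_all add: u_def nN d_def field_simps)
    have "?P (real (k + 1) / N) - ?P (real k / N)
      = c0 * d + e1 * (((u - x + 1) * d)^2 - ((u - x) * d)^2) + e2 * (((u - x + 1) * d)^3 - ((u - x) * d)^3)
        + e4 * (((u - x + 1) * d)^5 - ((u - x) * d)^5)"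
      unfolding a b unfolding c e1_def e2_def e4_def by (simp add: algebra_simps)
    also have "\<dots> = d * (a0 + a1 * u + a2 * u^2 + a3 * u^3 + a4 * u^4)"
      unfolding X_def a0_def a1_def a2_def a3_def a4_def by algebra
    finally show ?thesis
      unfolding I u_def[symmetric] using d by simp
  qed
  have "kantorovich n (\<lambda>t. c0 + c1 * (t - x) + c2 * (t - x)^2 + c4 * (t - x)^4) x
      = (\<Sum>k\<le>n. Bernstein n k x * (a0 + a1 * (real k - n * x) + a2 * (real k - n * x)^2
          + a3 * (real k - n * x)^3 + a4 * (real k - n * x)^4))"
    unfolding kantorovich_def I[symmetric] by (simp add: N_def add.commute)
  also have "\<dots> = a0 + a2 * (real n * X) + a3 * (real n * X * (1 - 2 * x))
      + a4 * (3 * (real n)^2 * X^2 + real n * X * (1 - 6 * X))"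
    unfolding X_def by (rule sum_Bernstein_quartic)
  also have "\<dots> = c0 + e1 * d * (1 - 2 * x) + 3 * e2 * d^2 * (X * (N - 2)) + e2 * d^2
      + c4 * d^4 * (3 * (real n)^2 * X^2 + real n * X * (5 - 20 * X)) + e4 * d^4 * ((1 - x)^5 + x^5)"
    unfolding a0_def a2_def a3_def a4_def nN e X_def by algebra
  also have "\<dots> = c0 + c1 * ((1 - 2 * x) / (2 * N)) + c2 * ((X * (N - 2) + 1 / 3) / N^2)
      + c4 * ((3 * (real n)^2 * X^2 + real n * X * (5 - 20 * X) + ((1 - x)^5 + x^5) / 5) / N^4)"
    unfolding e1_def e2_def e4_def d_def
    by (simp add: add_divide_distrib distrib_left power_one_over)
  finally show ?thesis
    by (simp add: kant_F_def X_def N_def)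
qed

lemma kant_F_nonneg:
  assumes "x \<in> {0..1}" "n \<ge> 1"
  shows "kant_F n x \<ge> 0"
  using assms by (simp add: kant_F_def)

text \<open>This decay of order \<open>1 / n\<close> later offsets the factor
  \<open>sqrt (n + 1)\<close> that the weighted AM-GM inequality introduces.\<close>

lemma kant_F_le:
  assumes "x \<in> {0..1}" "n \<ge> 1"
  shows "kant_F n x \<le> 1 / (4 * (real n + 1))"
proof -
  have "x * (1 - x) \<le> 1 / 4"
    using zero_le_power2[of "x - 1/2"] by (simp add: power2_eq_square algebra_simps)
  then have "x * (1 - x) * (real n - 1) \<le> 1 / 4 * (real n - 1)"
    using assms by (intro mult_right_mono) auto
  then have "x * (1 - x) * (real n - 1) + 1 / 3 \<le> (real n + 1) / 4"
    by simp
  then have "kant_F n x \<le> 1 / (real n + 1)\<^sup>2 * ((real n + 1) / 4)"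
    unfolding kant_F_def by (intro mult_left_mono) auto
  also have "\<dots> = 1 / (4 * (real n + 1))"
    by (simp add: power2_eq_square divide_simps)
  finally show ?thesis .
qed

text \<open>The left side is the fourth moment found in \<open>kantorovich_quartic\<close>; the
  factor \<open>24 / (n + 1)\<close> is the square of
  \<open>2 * sqrt 6 / sqrt (n + 1)\<close>.\<close>

lemma kantorovich_fourth_moment_le:
  fixes x X :: real and n :: nat
  assumes "x \<in> {0..1}" "n \<ge> 1"
  defines "X \<equiv> x * (1 - x)"
  shows "(3 * (real n)^2 * X^2 + real n * X * (5 - 20 * X) + ((1 - x)^5 + x^5) / 5) / (real n + 1)^4
    \<le> 24 / (real n + 1) * kant_F n x"
proof -
  have X: "0 \<le> X" "X \<le> 1 / 4"
    unfolding X_def using assms(1) mult_nonneg_nonneg[of x "1 - x"] zero_le_power2[of "x - 1/2"]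
    by (simp, simp add: power2_eq_square algebra_simps)
  define Y where "Y = (real n)^2 * X"
  have "Y * X \<le> Y * (1 / 4)" and Y: "0 \<le> Y"
    unfolding Y_def using X by (intro mult_left_mono mult_nonneg_nonneg; simp)+
  then have 1: "3 * (Y * X) \<le> 24 * Y"
    by linarith
  have 2: "real n * X * (5 - 20 * X) \<le> real n * (1 / 4) * 5"
    using X by (intro mult_mono) auto
  have "(1 - x)^5 \<le> 1" "x^5 \<le> 1"
    using assms by (auto intro: power_le_one)
  then have 3: "((1 - x)^5 + x^5) / 5 \<le> 1"
    by simp
  have "3 * (Y * X) + real n * X * (5 - 20 * X) + ((1 - x)^5 + x^5) / 5
      \<le> 24 * Y + real n * (1 / 4) * 5 + 1"
    by (intro add_mono 1 2 3)
  \<comment> \<open>This is the expanded target, as \<open>(n + 1) * (n - 1) = n^2 - 1\<close>. The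
    negative term costs at most 6, which the constant 8 absorbs.\<close>
  also have "\<dots> \<le> 24 * Y - 24 * X + 8 * real n + 8"
    using X(2) by simp
  also have "\<dots> = 24 * (real n + 1) * (X * (real n - 1) + 1 / 3)"
    by (simp add: Y_def algebra_simps power2_eq_square)
  finally have "3 * (real n)^2 * X^2 + real n * X * (5 - 20 * X) + ((1 - x)^5 + x^5) / 5
      \<le> 24 * (real n + 1) * (X * (real n - 1) + 1 / 3)"
    by (simp add: Y_def power2_eq_square mult_ac)
  then have "(3 * (real n)^2 * X^2 + real n * X * (5 - 20 * X) + ((1 - x)^5 + x^5) / 5) / (real n + 1)^4
      \<le> 24 * (real n + 1) * (X * (real n - 1) + 1 / 3) / (real n + 1)^4"
    by (rule divide_right_mono) simp
  also have "\<dots> = 24 / (real n + 1) * kant_F n x"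
    unfolding kant_F_def X_def by (simp add: divide_simps power2_eq_square power4_eq_xxxx) algebra
  finally show ?thesis .
qed

section \<open>Linearity and positivity of the operator\<close>

lemma cell_subset:
  assumes "k \<le> n"
  shows "{real k / real (n + 1) .. real (k + 1) / real (n + 1)} \<subseteq> {0..1}"
  using assms by (auto simp: field_simps)

lemma kantorovich_diff:
  assumes "f integrable_on {0..1}" "g integrable_on {0..1}"
  shows "kantorovich n (\<lambda>t. f t - g t) x = kantorovich n f x - kantorovich n g x"
proof -
  have "integral {real k / real (n + 1) .. real (k + 1) / real (n + 1)} (\<lambda>t. f t - g t)
     = integral {real k / real (n + 1) .. real (k + 1) / real (n + 1)} f
       - integral {real k / real (n + 1) .. real (k + 1) / real (n + 1)} g" if "k \<le> n" for k
    using assms cell_subset[OF that]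
    by (intro integral_diff) (blast intro: integrable_subinterval_real)+
  then show ?thesis
    unfolding kantorovich_def sum_subtractf[symmetric]
    by (intro sum.cong) (auto simp: right_diff_distrib)
qed

text \<open>Positivity: on \<open>[0,1]\<close> the Bernstein weights are nonnegative, so a
  pointwise majorant survives averaging.\<close>

lemma kantorovich_abs_le:
  assumes "f integrable_on {0..1}" "g integrable_on {0..1}" "x \<in> {0..1}"
    and le: "\<And>t. t \<in> {0..1} \<Longrightarrow> \<bar>f t\<bar> \<le> g t"
  shows "\<bar>kantorovich n f x\<bar> \<le> kantorovich n g x"
proof -
  have "\<bar>integral {real k / real (n + 1) .. real (k + 1) / real (n + 1)} f\<bar>
     \<le> integral {real k / real (n + 1) .. real (k + 1) / real (n + 1)} g" if "k \<le> n" for k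
  proof -
    note sub = cell_subset[OF that]
    show ?thesis
      unfolding real_norm_def[symmetric]
      using assms(1,2)[THEN integrable_subinterval_real, OF sub]
      by (rule integral_norm_bound_integral) (use le sub in \<open>unfold real_norm_def, blast\<close>)
  qed
  then show ?thesis
    unfolding kantorovich_def
    using assms(3)
    by (intro order_trans[OF sum_abs] sum_mono)
       (auto simp: abs_mult Bernstein_nonneg intro!: mult_left_mono)
qed

section \<open>Calculus with one-sided derivatives on the unit interval\<close>

lemma has_derivative_deriv01:
  assumes "f differentiable_on {0..1}" "t \<in> {0..1}"
  shows "(f has_real_derivative deriv01 f t) (at t within {0..1})"
  using assms unfolding deriv01_def has_real_derivative_iff_has_vector_derivative
    differentiable_on_def
  by (auto simp: vector_derivative_works[symmetric])

text \<open>Derivatives within \<open>[0,1]\<close> are unique, endpoints included. Agreement is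
  asked only on \<open>[0,1]\<close>, which permits differentiating a first derivative known only
  there.\<close>

lemma deriv01_eqI:
  assumes "\<And>s. s \<in> {0..1} \<Longrightarrow> f s = g s" "t \<in> {0..1}"
    and "(g has_real_derivative D) (at t within {0..1})"
  shows "deriv01 f t = D"
proof -
  have "(f has_real_derivative D) (at t within {0..1})"
    using assms by (intro has_field_derivative_transform_within[OF assms(3) zero_less_one]) auto
  then show ?thesis
    unfolding deriv01_def has_real_derivative_iff_has_vector_derivative
    using assms(2) by (intro vector_derivative_within_closed_interval) auto
qed

lemma C2_01_derivs:
  assumes "C2_01 f" "t \<in> {0..1}"
  shows "(f has_real_derivative deriv01 f t) (at t within {0..1})"
    and "(deriv01 f has_real_derivative deriv01 (deriv01 f) t) (at t within {0..1})"
  using assms has_derivative_deriv01 by (auto simp: C2_01_def)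

lemma C2_01_continuous:
  assumes "C2_01 f"
  shows "continuous_on {0..1} f" "continuous_on {0..1} (deriv01 f)"
    "continuous_on {0..1} (deriv01 (deriv01 f))"
  using assms by (auto simp: C2_01_def intro: differentiable_imp_continuous_on)

text \<open>Both claims are proved together because continuity of the second derivative of the
  product is read off from the Leibniz formula.\<close>

lemma
  assumes "C2_01 f" "C2_01 g"
  shows C2_01_mult: "C2_01 (\<lambda>t. f t * g t)"
    and deriv01_deriv01_mult: "\<And>t. t \<in> {0..1} \<Longrightarrow> deriv01 (deriv01 (\<lambda>t. f t * g t)) t
      = deriv01 (deriv01 f) t * g t + 2 * deriv01 f t * deriv01 g t + f t * deriv01 (deriv01 g) t"
proof -
  note D = C2_01_derivs[OF assms(1)] C2_01_derivs[OF assms(2)]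
  have D1: "((\<lambda>t. f t * g t) has_real_derivative deriv01 f t * g t + f t * deriv01 g t) (at t within {0..1})"
    if "t \<in> {0..1}" for t
    using D[OF that] by (auto intro!: derivative_eq_intros)
  have e1: "deriv01 (\<lambda>t. f t * g t) t = deriv01 f t * g t + f t * deriv01 g t" if "t \<in> {0..1}" for t
    using D1[OF that] that by (intro deriv01_eqI) auto
  have D2: "((\<lambda>t. deriv01 f t * g t + f t * deriv01 g t) has_real_derivative
      deriv01 (deriv01 f) t * g t + 2 * deriv01 f t * deriv01 g t + f t * deriv01 (deriv01 g) t)
      (at t within {0..1})" if "t \<in> {0..1}" for t
    using D[OF that] by (auto intro!: derivative_eq_intros)
  show e2: "deriv01 (deriv01 (\<lambda>t. f t * g t)) t
      = deriv01 (deriv01 f) t * g t + 2 * deriv01 f t * deriv01 g t + f t * deriv01 (deriv01 g) t"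
    if "t \<in> {0..1}" for t
    by (rule deriv01_eqI[OF e1 that D2[OF that]])
  have D2': "(deriv01 (\<lambda>t. f t * g t) has_real_derivative
      deriv01 (deriv01 f) t * g t + 2 * deriv01 f t * deriv01 g t + f t * deriv01 (deriv01 g) t)
      (at t within {0..1})" if "t \<in> {0..1}" for t
    using that e1 by (intro has_field_derivative_transform_within[OF D2[OF that] zero_less_one]) auto
  show "C2_01 (\<lambda>t. f t * g t)"
    unfolding C2_01_def
  proof (intro conjI)
    show "(\<lambda>t. f t * g t) differentiable_on {0..1}" "deriv01 (\<lambda>t. f t * g t) differentiable_on {0..1}"
      unfolding differentiable_on_def using D1 D2' real_differentiable_def by blast+
    show "continuous_on {0..1} (deriv01 (deriv01 (\<lambda>t. f t * g t)))"
      using C2_01_continuous[OF assms(1)] C2_01_continuous[OF assms(2)]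
      by (subst continuous_on_cong[OF refl e2]) (auto intro!: continuous_intros)
  qed
qed

section \<open>Uniform norm and modulus of continuity\<close>

text \<open>Provides the boundedness without which the real-valued suprema in
  \<open>sup_norm\<close> and \<open>modulus_cont\<close> would not be upper bounds.\<close>

lemma bounded_abs_continuous_01:
  fixes h :: "real \<Rightarrow> real"
  assumes "continuous_on {0..1} h"
  obtains B where "\<And>t. t \<in> {0..1} \<Longrightarrow> \<bar>h t\<bar> \<le> B"
proof -
  have "bounded (h ` {0..1})"
    using assms by (intro compact_imp_bounded compact_continuous_image) auto
  then obtain B where "\<forall>t\<in>{0..1}. \<bar>h t\<bar> \<le> B"
    by (auto simp: bounded_iff)
  then show ?thesis
    using that by blast
qed

lemma abs_le_sup_norm:
  assumes "continuous_on {0..1} h" "t \<in> {0..1}"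
  shows "\<bar>h t\<bar> \<le> sup_norm h"
proof -
  obtain B where "\<And>t. t \<in> {0..1} \<Longrightarrow> \<bar>h t\<bar> \<le> B"
    using bounded_abs_continuous_01[OF assms(1)] by blast
  then show ?thesis
    unfolding sup_norm_def using assms(2) by (intro cSUP_upper) (auto intro!: bdd_aboveI[of _ B])
qed

lemma abs_diff_le_modulus_cont:
  assumes "continuous_on {0..1} h" "u \<in> {0..1}" "v \<in> {0..1}" "\<bar>u - v\<bar> \<le> \<delta>"
  shows "\<bar>h u - h v\<bar> \<le> modulus_cont h \<delta>"
proof -
  obtain B where B: "\<And>t. t \<in> {0..1} \<Longrightarrow> \<bar>h t\<bar> \<le> B"
    using bounded_abs_continuous_01[OF assms(1)] by blast
  have "\<bar>h u - h v\<bar> \<le> 2 * B" if "u \<in> {0..1}" "v \<in> {0..1}" for u v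
    using B[OF that(1)] B[OF that(2)] by linarith
  then show ?thesis
    unfolding modulus_cont_def using assms by (intro cSup_upper) (auto intro!: bdd_aboveI[of _ "2 * B"])
qed

lemma abs_diff_le_nat_modulus_cont:
  assumes "continuous_on {0..1} h" "u \<in> {0..1}" "v \<in> {0..1}" "\<bar>u - v\<bar> \<le> real m * \<delta>"
  shows "\<bar>h u - h v\<bar> \<le> real m * modulus_cont h \<delta>"
proof (cases "m = 0")
  case True
  then show ?thesis using assms by simp
next
  case False
  \<comment> \<open>Equally spaced points cut the segment from \<open>u\<close> to \<open>v\<close>
    into \<open>m\<close> pieces of length at most \<open>\<delta>\<close>; the increments of
    \<open>h\<close> are then summed.\<close>
  define p where "p i = u + real i / real m * (v - u)" for i
  have p: "p i \<in> {0..1}" if "i \<le> m" for i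
  proof -
    have "(1 - real i / real m) *\<^sub>R u + (real i / real m) *\<^sub>R v \<in> {0..1}"
      using assms(2,3) that False by (intro convexD) auto
    moreover have "p i = (1 - real i / real m) *\<^sub>R u + (real i / real m) *\<^sub>R v"
      unfolding p_def real_scaleR_def by algebra
    ultimately show ?thesis by simp
  qed
  have d: "\<bar>p i - p (Suc i)\<bar> \<le> \<delta>" for i
  proof -
    have "p i - p (Suc i) = (u - v) / real m"
      using False by (simp add: p_def field_simps)
    then show ?thesis
      using assms(4) False by (simp add: abs_divide divide_le_eq mult.commute)
  qed
  have "\<bar>h (p 0) - h (p i)\<bar> \<le> real i * modulus_cont h \<delta>" if "i \<le> m" for i
    using that
  proof (induction i)
    case (Suc i)
    have "\<bar>h (p i) - h (p (Suc i))\<bar> \<le> modulus_cont h \<delta>"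
      using Suc.prems by (intro abs_diff_le_modulus_cont assms p d) auto
    then show ?case
      using Suc by (simp add: algebra_simps)
  qed simp
  from this[of m] show ?thesis
    using False by (simp add: p_def)
qed

text \<open>Keeps the argument \<open>a + \<delta>\<close> of the modulus fixed while
  \<open>s\<close> varies; only the variable part \<open>s\<close> is paid for, by a linear
  factor.\<close>

lemma abs_diff_le_modulus_cont_stretch:
  assumes h: "continuous_on {0..1} h" and uv: "u \<in> {0..1}" "v \<in> {0..1}"
    and le: "\<bar>u - v\<bar> \<le> a + s" and nn: "a \<ge> 0" "s \<ge> 0" "\<delta> > 0"
  shows "\<bar>h u - h v\<bar> \<le> (1 + s / \<delta>) * modulus_cont h (a + \<delta>)"
proof -
  \<comment> \<open>The \<open>Suc\<close> gives both \<open>m >= s / \<delta>\<close> and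
    \<open>m >= 1\<close>, so that \<open>m * (a + \<delta>)\<close> covers \<open>s\<close> and
    \<open>a\<close> at once.\<close>
  define m where "m = Suc (nat \<lfloor>s / \<delta>\<rfloor>)"
  have m: "s / \<delta> \<le> real m" "real m \<le> 1 + s / \<delta>" "1 \<le> real m"
    using nn by (auto simp: m_def) linarith
  have "s \<le> real m * \<delta>"
    using m(1) nn by (simp add: divide_le_eq)
  moreover have "1 * a \<le> real m * a"
    using m nn by (intro mult_right_mono) auto
  ultimately have "\<bar>u - v\<bar> \<le> real m * (a + \<delta>)"
    using le by (simp add: distrib_left)
  then have "\<bar>h u - h v\<bar> \<le> real m * modulus_cont h (a + \<delta>)"
    using h uv by (intro abs_diff_le_nat_modulus_cont)
  also have "0 \<le> modulus_cont h (a + \<delta>)"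
    using abs_diff_le_modulus_cont[OF h uv(1) uv(1), of "a + \<delta>"] nn by simp
  then have "real m * modulus_cont h (a + \<delta>) \<le> (1 + s / \<delta>) * modulus_cont h (a + \<delta>)"
    using m by (intro mult_right_mono)
  finally show ?thesis .
qed

section \<open>Newton interpolation with remainder\<close>

lemma second_derivative_zero_of_three_zeros:
  fixes w w' w'' :: "real \<Rightarrow> real"
  assumes "a < b" "b < c" "w a = 0" "w b = 0" "w c = 0"
    and cont: "continuous_on {a..c} w"
    and d1: "\<And>t. a < t \<Longrightarrow> t < c \<Longrightarrow> (w has_real_derivative w' t) (at t)"
    and d2: "\<And>t. a < t \<Longrightarrow> t < c \<Longrightarrow> (w' has_real_derivative w'' t) (at t)"
  obtains \<xi> where "a < \<xi>" "\<xi> < c" "w'' \<xi> = 0"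
proof -
  have 1: "\<exists>z. p < z \<and> z < q \<and> w' z = 0" if "a \<le> p" "p < q" "q \<le> c" "w p = w q" for p q
  proof -
    \<comment> \<open>\<open>Rolle_deriv\<close> speaks of the derivative as a linear map;
      evaluating it at 1 yields \<open>w' z = 0\<close>.\<close>
    have "\<exists>z. p < z \<and> z < q \<and> (*) (w' z) = (\<lambda>v. 0)"
      using that d1 continuous_on_subset[OF cont]
      by (intro Rolle_deriv[of p q w]) (auto simp: has_field_derivative_def)
    then show ?thesis
      by (metis mult.right_neutral)
  qed
  obtain p where p: "a < p" "p < b" "w' p = 0"
    using 1[of a b] assms by auto
  obtain q where q: "b < q" "q < c" "w' q = 0"
    using 1[of b c] assms by auto
  have "continuous_on {p..q} w'"
    using p q d2 by (intro DERIV_continuous_on[where D=w''])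
      (force intro: has_field_derivative_at_within)
  then have "\<exists>z. p < z \<and> z < q \<and> (*) (w'' z) = (\<lambda>v. 0)"
    using p q d2 by (intro Rolle_deriv) (auto simp: has_field_derivative_def)
  then obtain z where "p < z" "z < q" "w'' z = 0"
    by (metis mult.right_neutral)
  then show ?thesis
    using that[of z] p q by auto
qed

text \<open>Rolle's theorem places \<open>\<xi>\<close> between the least and the greatest of
  \<open>x\<close>, \<open>y\<close>, \<open>t\<close>, which gives the bound on its distance from
  \<open>x\<close>.\<close>

lemma newton_interpolation_remainder:
  assumes h: "C2_01 h" and in01: "x \<in> {0..1}" "y \<in> {0..1}" "t \<in> {0..1}" and "x \<noteq> y"
  obtains \<xi> where "\<xi> \<in> {0..1}" "\<bar>\<xi> - x\<bar> \<le> \<bar>x - y\<bar> + \<bar>t - x\<bar>"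
    "h t = h x + divided_difference x y h * (t - x) + deriv01 (deriv01 h) \<xi> / 2 * ((t - x) * (t - y))"
proof (cases "t = x \<or> t = y")
  case True
  have "divided_difference x y h * (y - x) = h y - h x"
    using \<open>x \<noteq> y\<close> by (simp add: divided_difference_def field_simps)
  \<comment> \<open>At a node the quadratic factor vanishes, so any \<open>\<xi>\<close> serves;
    \<open>x\<close> meets the distance bound trivially.\<close>
  with True show ?thesis
    using that[of x] in01 by auto
next
  case False
  define D where "D = divided_difference x y h"
  have D: "D * (y - x) = h y - h x"
    using \<open>x \<noteq> y\<close> by (simp add: D_def divided_difference_def field_simps)
  \<comment> \<open>\<open>c\<close> is chosen to make \<open>w\<close> below vanish at
    \<open>t\<close> as well as at the nodes.\<close>
  define c where "c = (h t - h x - D * (t - x)) / ((t - x) * (t - y))"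
  have c: "c * ((t - x) * (t - y)) = h t - h x - D * (t - x)"
    using False by (simp add: c_def)
  define w where "w s = h s - h x - D * (s - x) - c * ((s - x) * (s - y))" for s
  have w0: "w s = 0" if "s \<in> {x, y, t}" for s
    using that D c by (auto simp: w_def)
  have "\<exists>p q r. p < q \<and> q < r \<and> {p, q, r} \<subseteq> {x, y, t}"
    using False \<open>x \<noteq> y\<close>
    by (cases x y rule: linorder_cases; cases y t rule: linorder_cases; cases x t rule: linorder_cases) blast+
  then obtain p q r where pqr: "p < q" "q < r" "p \<in> {x, y, t}" "q \<in> {x, y, t}" "r \<in> {x, y, t}"
    by auto
  have pr: "p \<in> {0..1}" "r \<in> {0..1}"
    using pqr in01 by auto
  \<comment> \<open>Strictly between the outer zeros the one-sided derivatives become two-sided, as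
    Rolle's theorem requires.\<close>
  have at: "(at s within {0..1}) = at s" if "p < s" "s < r" for s
    using that pr by (intro at_within_interior) auto
  obtain \<xi> where xi: "p < \<xi>" "\<xi> < r" "deriv01 (deriv01 h) \<xi> - 2 * c = 0"
  proof (rule second_derivative_zero_of_three_zeros[OF pqr(1,2) w0 w0 w0])
    show "continuous_on {p..r} w"
      unfolding w_def using pr
      by (auto intro!: continuous_intros continuous_on_subset[OF C2_01_continuous(1)[OF h]])
    show "(w has_real_derivative deriv01 h s - D - c * ((s - x) + (s - y))) (at s)"
      if "p < s" "s < r" for s
      unfolding w_def using C2_01_derivs(1)[OF h, of s] that pr at[OF that]
      by (auto intro!: derivative_eq_intros simp: algebra_simps)
    show "((\<lambda>s. deriv01 h s - D - c * ((s - x) + (s - y))) has_real_derivative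
        deriv01 (deriv01 h) s - 2 * c) (at s)"
      if "p < s" "s < r" for s
      using C2_01_derivs(2)[OF h, of s] that pr at[OF that]
      by (auto intro!: derivative_eq_intros simp: algebra_simps)
  qed (use pqr in auto)
  have "\<bar>\<xi> - x\<bar> \<le> \<bar>x - y\<bar> + \<bar>t - x\<bar>"
    using xi(1,2) pqr(3,5) by auto
  moreover have "h t = h x + D * (t - x) + deriv01 (deriv01 h) \<xi> / 2 * ((t - x) * (t - y))"
    using c xi(3) by simp
  ultimately show ?thesis
    using that[of \<xi>] xi pr by (auto simp: D_def)
qed

section \<open>The remainder estimate and its application to products\<close>

lemma kantorovich_newton_remainder_le:
  fixes h :: "real \<Rightarrow> real" and n :: nat
  assumes h: "C2_01 h" and n: "n \<ge> 1" and x: "x \<in> {0..1}" and y: "y \<in> {0..1}" and "x \<noteq> y"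
  defines "m \<equiv> (1 - 2 * x) / (2 * (real n + 1))"
  shows "\<bar>kantorovich n h x - h x - divided_difference x y h * m
      - deriv01 (deriv01 h) x / 2 * (kant_F n x + (x - y) * m)\<bar>
    \<le> (kant_F n x + \<bar>x - y\<bar> * (1 / (sqrt 3 * sqrt (real n + 1))))
      * modulus_cont (deriv01 (deriv01 h)) (\<bar>x - y\<bar> + 2 * sqrt 6 / sqrt (real n + 1))"
proof -
  define r where "r = sqrt (real n + 1)"
  define \<delta> where "\<delta> = 2 * sqrt 6 / r"
  define a where "a = \<bar>x - y\<bar>"
  define W where "W = modulus_cont (deriv01 (deriv01 h)) (a + \<delta>)"
  define D where "D = divided_difference x y h"
  define H where "H = deriv01 (deriv01 h) x"
  define F where "F = kant_F n x"
  define M where "M = (3 * (real n)^2 * (x * (1 - x))^2 + real n * (x * (1 - x)) * (5 - 20 * (x * (1 - x)))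
    + ((1 - x)^5 + x^5) / 5) / (real n + 1)^4"
  have r: "r > 0" "r\<^sup>2 = real n + 1"
    by (simp_all add: r_def)
  have d: "\<delta> > 0" "\<delta>\<^sup>2 = 24 / r\<^sup>2"
    using r by (simp_all add: \<delta>_def power_divide power_mult_distrib)
  have a: "a \<ge> 0" by (simp add: a_def)
  have cont: "continuous_on {0..1} (deriv01 (deriv01 h))"
    using C2_01_continuous[OF h] by blast
  have W: "W \<ge> 0"
    using abs_diff_le_modulus_cont[OF cont x x, of "a + \<delta>"] a d by (simp add: W_def)
  \<comment> \<open>The Newton form with second derivative frozen at \<open>x\<close>, rewritten by
    \<open>(t - x) * (t - y) = (t - x)^2 + (x - y) * (t - x)\<close>. Zero terms here and in
    \<open>Q\<close> match the shape of \<open>kantorovich_quartic\<close>.\<close>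
  define P where "P t = h x + (D + H / 2 * (x - y)) * (t - x) + H / 2 * (t - x)^2 + 0 * (t - x)^4" for t
  define Q where "Q t = W / 2 * (a / (2 * r)) + 0 * (t - x)
    + W / 2 * (3 / 2 + a * (r / 2 + 1 / \<delta>)) * (t - x)^2 + W / (4 * \<delta>\<^sup>2) * (t - x)^4" for t
  have PI: "P integrable_on {0..1}" and QI: "Q integrable_on {0..1}"
    unfolding P_def Q_def by (intro integrable_continuous_real continuous_intros)+
  have hI: "h integrable_on {0..1}"
    using C2_01_continuous[OF h] by (intro integrable_continuous_real)
  have le: "\<bar>h t - P t\<bar> \<le> Q t" if t: "t \<in> {0..1}" for t
  proof -
    obtain \<xi> where xi: "\<xi> \<in> {0..1}" "\<bar>\<xi> - x\<bar> \<le> a + \<bar>t - x\<bar>"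
      "h t = h x + D * (t - x) + deriv01 (deriv01 h) \<xi> / 2 * ((t - x) * (t - y))"
      using newton_interpolation_remainder[OF h x y t \<open>x \<noteq> y\<close>] unfolding a_def D_def by metis
    define s where "s = \<bar>t - x\<bar>"
    have s: "s \<ge> 0" "s\<^sup>2 = (t - x)\<^sup>2" "s^4 = (t - x)^4"
      by (simp_all add: s_def)
    have "\<bar>deriv01 (deriv01 h) \<xi> - H\<bar> \<le> (1 + s / \<delta>) * W"
      unfolding W_def H_def
      using xi(2) s a d by (intro abs_diff_le_modulus_cont_stretch[OF cont xi(1) x]) (auto simp: s_def)
    moreover have "\<bar>(t - x) * (t - y)\<bar> \<le> s * (s + a)"
      unfolding abs_mult s_def a_def by (intro mult_left_mono) auto
    ultimately have "\<bar>deriv01 (deriv01 h) \<xi> - H\<bar> * \<bar>(t - x) * (t - y)\<bar> \<le> ((1 + s / \<delta>) * W) * (s * (s + a))"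
      using s W d by (intro mult_mono) auto
    moreover have "h t - P t = (deriv01 (deriv01 h) \<xi> - H) * ((t - x) * (t - y)) / 2"
      unfolding xi(3) P_def by (simp add: field_simps power2_eq_square)
    ultimately have "\<bar>h t - P t\<bar> \<le> ((1 + s / \<delta>) * W) * (s * (s + a)) / 2"
      by (simp only: abs_mult abs_divide) simp
    then have "\<bar>h t - P t\<bar> \<le> W / 2 * ((1 + s / \<delta>) * (s * (s + a)))"
      by (simp add: mult_ac)
    also have "(1 + s / \<delta>) * (s * (s + a)) = s\<^sup>2 + s * (s\<^sup>2 / \<delta>) + a * (s + s\<^sup>2 / \<delta>)"
      by (simp add: algebra_simps power2_eq_square)
    \<comment> \<open>AM-GM removes the cubic and the linear power of \<open>s\<close>. The weight
      \<open>r\<close> in the linear case is balanced: \<open>s^2\<close> averages to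
      \<open>F\<close>, of order at most \<open>1 / r^2\<close>, so both summands contribute at most
      order \<open>1 / r\<close>.\<close>
    also have "W / 2 * \<dots> \<le> W / 2 * (s\<^sup>2 + (s\<^sup>2 + (s\<^sup>2 / \<delta>)\<^sup>2) / 2 + a * ((r * s\<^sup>2 + 1 / r) / 2 + s\<^sup>2 / \<delta>))"
    proof -
      have "s * (s\<^sup>2 / \<delta>) \<le> (s\<^sup>2 + (s\<^sup>2 / \<delta>)\<^sup>2) / 2"
        using sum_squares_bound[of s "s\<^sup>2 / \<delta>"] by (simp add: mult_ac)
      moreover have "s \<le> (r * s\<^sup>2 + 1 / r) / 2"
        using sum_squares_bound[of "r * s" 1] r by (simp add: field_simps power2_eq_square)
      ultimately show ?thesis
        using W a by (intro mult_left_mono add_mono) auto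
    qed
    also have "\<dots> = Q t"
    proof -
      define i j where "i = 1 / \<delta>" and "j = 1 / r"
      have ij: "s\<^sup>2 / \<delta> = s\<^sup>2 * i" "a / (2 * r) = a * j / 2" "W / (4 * \<delta>\<^sup>2) = W * i\<^sup>2 / 4"
        by (simp_all add: i_def j_def power_one_over)
      show ?thesis
        unfolding Q_def s(2,3)[symmetric] ij unfolding i_def[symmetric] j_def[symmetric]
        by (simp add: algebra_simps add_divide_distrib power2_eq_square power4_eq_xxxx)
    qed
    finally show ?thesis .
  qed
  have "\<bar>kantorovich n h x - kantorovich n P x\<bar> \<le> kantorovich n Q x"
    unfolding kantorovich_diff[OF hI PI, symmetric]
    by (rule kantorovich_abs_le[OF integrable_diff[OF hI PI] QI x le])
  also have "kantorovich n P x = h x + D * m + H / 2 * (F + (x - y) * m)"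
    unfolding P_def F_def
    by (subst kantorovich_quartic, fold m_def)
       (simp add: algebra_simps add_divide_distrib diff_divide_distrib)
  also have "kantorovich n Q x = W / 2 * (a / (2 * r)) + W / 2 * (3 / 2 + a * (r / 2 + 1 / \<delta>)) * F
      + W / (4 * \<delta>\<^sup>2) * M"
    unfolding Q_def F_def M_def by (subst kantorovich_quartic) simp
  also have "\<dots> = W / 2 * (3 / 2 * F + M / (2 * \<delta>\<^sup>2) + a * (1 / (2 * r) + (r / 2 + 1 / \<delta>) * F))"
    by (simp add: algebra_simps)
  also have "\<dots> \<le> W / 2 * (2 * F + a * (2 * (1 / (sqrt 3 * r))))"
  proof -
    have "M \<le> \<delta>\<^sup>2 * F"
      using kantorovich_fourth_moment_le[OF x n] by (simp add: M_def F_def d r)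
    then have "M / (2 * \<delta>\<^sup>2) \<le> \<delta>\<^sup>2 * F / (2 * \<delta>\<^sup>2)"
      by (rule divide_right_mono) simp
    also have "\<dots> = F / 2"
      using d(1) by simp
    finally have "M / (2 * \<delta>\<^sup>2) \<le> F / 2" .
    moreover have "1 / (2 * r) + (r / 2 + 1 / \<delta>) * F \<le> 2 * (1 / (sqrt 3 * r))"
    \<comment> \<open>Since \<open>r / 2 + 1 / \<delta> <= r\<close> and
      \<open>F <= 1 / (4 * r^2)\<close>, the left side is at most \<open>3 / (4 * r)\<close>, below
      \<open>1 / r\<close> and hence below \<open>2 / (sqrt 3 * r)\<close>.\<close>
    proof -
      have "sqrt 6 \<ge> 1" by simp
      then have "1 / \<delta> \<le> r / 2"
        using r by (simp add: \<delta>_def field_simps)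
      moreover have "F \<le> 1 / (4 * r\<^sup>2)" "0 \<le> F"
        using kant_F_le[OF x n] kant_F_nonneg[OF x n] by (simp_all add: r F_def)
      ultimately have "(r / 2 + 1 / \<delta>) * F \<le> r * (1 / (4 * r\<^sup>2))"
        using r by (intro mult_mono) auto
      also have "\<dots> = 1 / (4 * r)"
        using r(1) by (simp add: power2_eq_square)
      finally have "1 / (2 * r) + (r / 2 + 1 / \<delta>) * F \<le> 1 / (2 * r) + 1 / (4 * r)"
        by simp
      also have "\<dots> \<le> 1 / r"
        using r(1) by (simp add: field_simps)
      also have "sqrt 3 \<le> 2"
        by (rule real_le_lsqrt) auto
      then have "1 / r \<le> 2 * (1 / (sqrt 3 * r))"
        using r(1) by (simp add: field_simps)
      finally show ?thesis .
    qed
    ultimately show ?thesis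
      using W a by (intro mult_left_mono add_mono) auto
  qed
  also have "\<dots> = (F + a * (1 / (sqrt 3 * r))) * W"
    by (simp add: algebra_simps)
  finally show ?thesis
    unfolding F_def a_def r_def W_def D_def H_def \<delta>_def by (simp add: algebra_simps)
qed

theorem mainTheorem2:
  fixes f g :: "real \<Rightarrow> real" and n :: nat and x y :: real
  assumes "C2_01 f" and "C2_01 g"
    and "n \<ge> 1"
    and "x \<in> {0..1}" and "y \<in> {0..1}" and "x \<noteq> y"
  shows "\<bar>kantorovich n (\<lambda>t. f t * g t) x - kantorovich n f x * kantorovich n g x
            + (x - y) * ((1 - 2 * x) / (2 * (real n + 1)))
              * (divided_difference x y f * divided_difference x y g - deriv01 f x * deriv01 g x)\<bar>
     \<le> (1 / (real n + 1)\<^sup>2 * (x * (1 - x) * (real n - 1) + 1 / 3)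
          + \<bar>x - y\<bar> * (1 / (sqrt 3 * sqrt (real n + 1))))
       * (modulus_cont (deriv01 (deriv01 (\<lambda>t. f t * g t))) (\<bar>x - y\<bar> + 2 * sqrt 6 / sqrt (real n + 1))
          + sup_norm g * modulus_cont (deriv01 (deriv01 f)) (\<bar>x - y\<bar> + 2 * sqrt 6 / sqrt (real n + 1))
          + sup_norm f * modulus_cont (deriv01 (deriv01 g)) (\<bar>x - y\<bar> + 2 * sqrt 6 / sqrt (real n + 1)))
       + \<bar>kantorovich n f x - f x\<bar> * \<bar>kantorovich n g x - g x\<bar>
       + \<bar>kant_F n x\<bar> * \<bar>deriv01 f x * deriv01 g x\<bar>"
proof -
  define m where "m = (1 - 2 * x) / (2 * (real n + 1))"
  define A where "A = kant_F n x + \<bar>x - y\<bar> * (1 / (sqrt 3 * sqrt (real n + 1)))"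
  define \<omega> where "\<omega> h = modulus_cont (deriv01 (deriv01 h)) (\<bar>x - y\<bar> + 2 * sqrt 6 / sqrt (real n + 1))"
    for h
  define R where "R h = kantorovich n h x - h x - divided_difference x y h * m
      - deriv01 (deriv01 h) x / 2 * (kant_F n x + (x - y) * m)" for h
  let ?fg = "\<lambda>t. f t * g t"
  note C2 = assms(1,2) C2_01_mult[OF assms(1,2)]
  have R: "\<bar>R h\<bar> \<le> A * \<omega> h" if "C2_01 h" for h
    unfolding R_def A_def \<omega>_def m_def
    by (rule kantorovich_newton_remainder_le[OF that assms(3-6)])
  have fgR: "\<bar>u x * R h\<bar> \<le> A * (sup_norm u * \<omega> h)" if "C2_01 u" "C2_01 h" for u h
  proof -
    have "\<bar>u x * R h\<bar> \<le> sup_norm u * (A * \<omega> h)"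
      unfolding abs_mult using R[OF that(2)] abs_le_sup_norm[OF C2_01_continuous(1)[OF that(1)] assms(4)]
      by (intro mult_mono) auto
    then show ?thesis by (simp add: mult_ac)
  qed
  define p q where "p = divided_difference x y f" and "q = divided_difference x y g"
  \<comment> \<open>Eliminating the values at \<open>y\<close> reduces the product rule for divided
    differences to algebra.\<close>
  have y: "f y = f x - (x - y) * p" "g y = g x - (x - y) * q"
    using \<open>x \<noteq> y\<close> by (simp_all add: p_def q_def divided_difference_def)
  have "divided_difference x y ?fg = (x - y) * (p * g x + f x * q - (x - y) * p * q) / (x - y)"
    unfolding divided_difference_def y by (simp add: algebra_simps)
  then have dd: "divided_difference x y ?fg = p * g x + f x * q - (x - y) * p * q"
    using \<open>x \<noteq> y\<close> by simp
  \<comment> \<open>The term \<open>(x - y) * p * q\<close> of the product rule, multiplied by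
    \<open>m\<close>, and the mixed term \<open>2 f' g'\<close> of the Leibniz formula produce
    exactly the correction on the left, up to \<open>F f' g'\<close>.\<close>
  have eq: "kantorovich n ?fg x - kantorovich n f x * kantorovich n g x
      + (x - y) * m * (p * q - deriv01 f x * deriv01 g x)
    = R ?fg - f x * R g - g x * R f
      - (kantorovich n f x - f x) * (kantorovich n g x - g x)
      + kant_F n x * (deriv01 f x * deriv01 g x)"
    unfolding R_def dd deriv01_deriv01_mult[OF assms(1,2,4)] p_def[symmetric] q_def[symmetric]
    by (simp add: algebra_simps add_divide_distrib diff_divide_distrib)
  have "\<bar>kantorovich n ?fg x - kantorovich n f x * kantorovich n g x
      + (x - y) * m * (p * q - deriv01 f x * deriv01 g x)\<bar>
    \<le> \<bar>R ?fg\<bar> + \<bar>f x * R g\<bar> + \<bar>g x * R f\<bar>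
      + \<bar>kantorovich n f x - f x\<bar> * \<bar>kantorovich n g x - g x\<bar>
      + \<bar>kant_F n x\<bar> * \<bar>deriv01 f x * deriv01 g x\<bar>"
    unfolding eq abs_mult[of "kantorovich n f x - f x", symmetric] abs_mult[of "kant_F n x", symmetric]
    by linarith
  also have "\<dots> \<le> A * (\<omega> ?fg + sup_norm g * \<omega> f + sup_norm f * \<omega> g)
      + \<bar>kantorovich n f x - f x\<bar> * \<bar>kantorovich n g x - g x\<bar>
      + \<bar>kant_F n x\<bar> * \<bar>deriv01 f x * deriv01 g x\<bar>"
    using R[OF C2(3)] fgR[OF C2(1,2)] fgR[OF C2(2,1)] by (simp add: distrib_left)
  finally show ?thesis
    unfolding A_def \<omega>_def m_def p_def q_def kant_F_def .
qed

end
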